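(* For every positive integer $n$, the congruence lattice of the extra slow Tamari lattice $\operatorname{esTam}_n$ is isomorphic to the lattice of order ideals (down-sets, ordered by inclusion) of the opposite of the inclusion poset of colored intervals of size $n$.
   Context: Let $n$ be a positive integer. The board of size $n$ is the Ferrers diagram of shape $(n,n,n-1,n-2,\dots,3,2)$ (a single cell $(1,1)$ if $n=1$). Its cells are written $(i,j)$, where $i$ is the row, numbered from the top, and $j$ is the column label, the columns being labelled $n,n-1,\dots,1$ from left to right. So the cells are $(1,j)$ for $1\le j\le n$ and $(i,j)$ for $2\le i\le n$, $i-1\le j\le n$. The root is $(1,n)$ (top-left cell); the border cells are $(i,i-1)$ for $2\le i\le n$ (the rightmost cells of rows $2,\dots,n$). An fb-tableau of size $n$ is a filling in which each cell is either empty or nonempty such that the root and all border cells are nonempty, and every nonempty cell other than the root has a nonempty cell strictly to its left in the same row or strictly above it in the same column. In an fb-tableau, a nonempty cell different from the root is called a left-arrow if there is no nonempty cell strictly to its left in its row, an up-arrow if there is no nonempty cell strictly above it in its column, and a dot otherwise; the root is also a dot. (Each of rows $2,\dots,n$ has exactly one left-arrow, each of columns $1,\dots,n-1$ has exactly one up-arrow.) A cell is free in $T$ if it lies strictly below an up-arrow (same column) and strictly to the right of a left-arrow (same row); a free cell is either empty or contains a dot. $\operatorname{Row}(T)$ is the set of cells lying weakly to the right of a left-arrow or of the root in the same row; $\operatorname{Col}(T)$ is the set of cells lying weakly below an up-arrow or the root in the same column. For fb-tableaux $S,T$ of size $n$, write $S\lhd T$ if (1) $\operatorname{Col}(S)\subseteq\operatorname{Col}(T)$;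 (2) $\operatorname{Row}(T)\subseteq\operatorname{Row}(S)$; (3) for every cell $c$ that is free in both $S$ and $T$, if $c$ contains a dot in $S$ then $c$ contains a dot in $T$. The extra slow Tamari lattice $\operatorname{esTam}_n$ is the set of fb-tableaux of size $n$ ordered by $\lhd$; it is a finite lattice. A congruence of a lattice is an equivalence relation compatible with $\wedge$ and $\vee$; the congruence lattice is the set of all congruences ordered by inclusion of relations. The colored intervals of size $n$ are the formal symbols $[i,j]_{\mathtt{red}}$ and $[i,j]_{\mathtt{green}}$ for $1\le i\le j\le n-1$, and $[i,j]_{\mathtt{blue}}$ for $1\le i<j\le n-1$. The inclusion poset of colored intervals of size $n$ is this set with the reflexive relation $\subseteq$ whose non-trivial relations are exactly: (1) $[i,j]_{\mathtt{red}}\subseteq[i,k]_\sigma$ for $j<k$ and every color $\sigma$; (2) $[i,j]_{\mathtt{green}}\subseteq[k,j]_\sigma$ for $k<i$ and every color $\sigma$; (3) $[i,j]_\sigma\subseteq[k,\ell]_\tau$ for $k<i\le j<\ell$, $\sigma\in\{\mathtt{red},\mathtt{green}\}$ and every color $\tau$. *)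

theory Defs
  imports "HOL-Algebra.Lattice"
begin

section \<open>fb-tableaux\<close>

text \<open>A cell \<open>(i, j)\<close> is given by its row \<open>i\<close>, numbered from the top, and its column label \<open>j\<close>.
  Column labels decrease from left to right, so ``strictly to the left'' means ``larger label''.\<close>

type_synonym cell = "nat \<times> nat"

definition board :: "nat \<Rightarrow> cell set" where
  "board n = {(1, j) | j. 1 \<le> j \<and> j \<le> n} \<union> {(i, j) | i j. 2 \<le> i \<and> i \<le> n \<and> i - 1 \<le> j \<and> j \<le> n}"

definition root :: "nat \<Rightarrow> cell" where
  "root n = (1, n)"

definition border :: "nat \<Rightarrow> cell set" where
  "border n = {(i, i - 1) | i. 2 \<le> i \<and> i \<le> n}"

text \<open>\<open>left_of c d\<close> and \<open>above c d\<close>: the cell \<open>c\<close> is strictly to the left of, resp. strictly above,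
  the cell \<open>d\<close> in the same row, resp. column.\<close>

definition left_of :: "cell \<Rightarrow> cell \<Rightarrow> bool" where
  "left_of c d \<longleftrightarrow> fst c = fst d \<and> snd c > snd d"

definition above :: "cell \<Rightarrow> cell \<Rightarrow> bool" where
  "above c d \<longleftrightarrow> snd c = snd d \<and> fst c < fst d"

text \<open>A filling is encoded by the set of its nonempty cells.\<close>

definition fb_tableau :: "nat \<Rightarrow> cell set \<Rightarrow> bool" where
  "fb_tableau n T \<longleftrightarrow> T \<subseteq> board n \<and> root n \<in> T \<and> border n \<subseteq> T \<and>
     (\<forall>c\<in>T. c \<noteq> root n \<longrightarrow> (\<exists>d\<in>T. left_of d c \<or> above d c))"

definition left_arrows :: "nat \<Rightarrow> cell set \<Rightarrow> cell set" where
  "left_arrows n T = {c \<in> T. c \<noteq> root n \<and> \<not> (\<exists>d\<in>T. left_of d c)}"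

definition up_arrows :: "nat \<Rightarrow> cell set \<Rightarrow> cell set" where
  "up_arrows n T = {c \<in> T. c \<noteq> root n \<and> \<not> (\<exists>d\<in>T. above d c)}"

definition dots :: "nat \<Rightarrow> cell set \<Rightarrow> cell set" where
  "dots n T = T - left_arrows n T - up_arrows n T"

definition free_cells :: "nat \<Rightarrow> cell set \<Rightarrow> cell set" where
  "free_cells n T =
     {c \<in> board n. (\<exists>u\<in>up_arrows n T. above u c) \<and> (\<exists>l\<in>left_arrows n T. left_of l c)}"

definition Row :: "nat \<Rightarrow> cell set \<Rightarrow> cell set" where
  "Row n T = {c \<in> board n. \<exists>d\<in>insert (root n) (left_arrows n T). d = c \<or> left_of d c}"

definition Col :: "nat \<Rightarrow> cell set \<Rightarrow> cell set" where
  "Col n T = {c \<in> board n. \<exists>d\<in>insert (root n) (up_arrows n T). d = c \<or> above d c}"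


section \<open>The extra slow Tamari lattice\<close>

definition fb_le :: "nat \<Rightarrow> cell set \<Rightarrow> cell set \<Rightarrow> bool" where
  "fb_le n S T \<longleftrightarrow> Col n S \<subseteq> Col n T \<and> Row n T \<subseteq> Row n S \<and>
     (\<forall>c \<in> free_cells n S \<inter> free_cells n T. c \<in> dots n S \<longrightarrow> c \<in> dots n T)"

definition esTam :: "nat \<Rightarrow> cell set gorder" where
  "esTam n = \<lparr>carrier = {T. fb_tableau n T}, eq = (=), le = fb_le n\<rparr>"


section \<open>Congruences, order ideals and order isomorphisms\<close>

definition lattice_congruence :: "('a, 'b) gorder_scheme \<Rightarrow> 'a rel \<Rightarrow> bool" where
  "lattice_congruence L r \<longleftrightarrow> equiv (carrier L) r \<and>
     (\<forall>(x, x') \<in> r. \<forall>(y, y') \<in> r.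
        (x \<sqinter>\<^bsub>L\<^esub> y, x' \<sqinter>\<^bsub>L\<^esub> y') \<in> r \<and> (x \<squnion>\<^bsub>L\<^esub> y, x' \<squnion>\<^bsub>L\<^esub> y') \<in> r)"

definition congruence_lattice :: "('a, 'b) gorder_scheme \<Rightarrow> 'a rel gorder" where
  "congruence_lattice L = \<lparr>carrier = {r. lattice_congruence L r}, eq = (=), le = (\<subseteq>)\<rparr>"

definition order_ideal :: "('a, 'b) gorder_scheme \<Rightarrow> 'a set \<Rightarrow> bool" where
  "order_ideal P D \<longleftrightarrow> D \<subseteq> carrier P \<and> (\<forall>x\<in>D. \<forall>y\<in>carrier P. y \<sqsubseteq>\<^bsub>P\<^esub> x \<longrightarrow> y \<in> D)"

definition ideal_lattice :: "('a, 'b) gorder_scheme \<Rightarrow> 'a set gorder" where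
  "ideal_lattice P = \<lparr>carrier = {D. order_ideal P D}, eq = (=), le = (\<subseteq>)\<rparr>"

text \<open>Between lattices, an order isomorphism is the same as a lattice isomorphism.\<close>

definition order_isomorphic :: "('a, 'c) gorder_scheme \<Rightarrow> ('b, 'd) gorder_scheme \<Rightarrow> bool" where
  "order_isomorphic P Q \<longleftrightarrow> (\<exists>f. bij_betw f (carrier P) (carrier Q) \<and>
     (\<forall>x\<in>carrier P. \<forall>y\<in>carrier P. x \<sqsubseteq>\<^bsub>P\<^esub> y \<longleftrightarrow> f x \<sqsubseteq>\<^bsub>Q\<^esub> f y))"


section \<open>Colored intervals\<close>

datatype color = Red | Green | Blue

datatype colored_interval = CI (lo: nat) (hi: nat) (col: color)

definition colored_intervals :: "nat \<Rightarrow> colored_interval set" where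
  "colored_intervals n =
     {CI i j s | i j s. 1 \<le> i \<and> i \<le> j \<and> j \<le> n - 1 \<and> s \<in> {Red, Green}} \<union>
     {CI i j Blue | i j. 1 \<le> i \<and> i < j \<and> j \<le> n - 1}"

inductive interval_le :: "colored_interval \<Rightarrow> colored_interval \<Rightarrow> bool" where
  refl: "interval_le x x"
| red: "j < k \<Longrightarrow> interval_le (CI i j Red) (CI i k s)"
| green: "k < i \<Longrightarrow> interval_le (CI i j Green) (CI k j s)"
| inner: "k < i \<Longrightarrow> i \<le> j \<Longrightarrow> j < l \<Longrightarrow> s \<in> {Red, Green} \<Longrightarrow> interval_le (CI i j s) (CI k l t)"

definition interval_poset :: "nat \<Rightarrow> colored_interval gorder" where
  "interval_poset n = \<lparr>carrier = colored_intervals n, eq = (=), le = interval_le\<rparr>"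

end

theory Submission
  imports Defs
begin

text \<open>A tableau is encoded by a set of colored intervals, the value of the cell \<open>(i + 1, j)\<close> being
  recorded by the interval \<open>[i, j]\<close> in green, blue and red. Under this encoding the order becomes
  inclusion and the tableaux become the sets closed under \<open>R \<Rightarrow> B \<Rightarrow> G\<close> on each interval, under
  \<open>G [i, j] \<Rightarrow> G [i + 1, j]\<close>, and under \<open>R [i, k] \<and> G [i + 1, j] \<Rightarrow> R [i, j]\<close> for \<open>k < j\<close>. All these
  rules are Horn clauses, so the closed sets form a lattice whose join is the closure of the union,
  and the join-irreducible elements are the sets generated by a single colored interval.
  To close a union of two closed sets, only the last rule is needed, with a conclusion of any color;
  its premises are then smaller in the inclusion poset. Hence whether an interval belongs to a join
  depends only on the intervals below it, which makes every up-set contractible, while the same rule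
  shows that contracting an interval forces the contraction of everything above it.\<close>

section \<open>Lattices of sets\<close>

text \<open>\<open>cl\<close> has to produce members of the family only from unions of two members.
  This leaves room for an operator that applies fewer rules than those defining the family.\<close>

locale set_lattice =
  fixes L :: "('a, 'b) gorder_scheme" and D :: "'a \<Rightarrow> 'p set" and cl :: "'p set \<Rightarrow> 'p set"
  assumes eq_L: "eq L = (=)"
    and inj_D: "inj_on D (carrier L)"
    and le_iff: "x \<in> carrier L \<Longrightarrow> y \<in> carrier L \<Longrightarrow> x \<sqsubseteq>\<^bsub>L\<^esub> y \<longleftrightarrow> D x \<subseteq> D y"
    and Int_closed: "X \<in> D ` carrier L \<Longrightarrow> Y \<in> D ` carrier L \<Longrightarrow> X \<inter> Y \<in> D ` carrier L"
    and cl_closed: "X \<in> D ` carrier L \<Longrightarrow> Y \<in> D ` carrier L \<Longrightarrow> cl (X \<union> Y) \<in> D ` carrier L"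
    and cl_upper: "A \<subseteq> cl A"
    and cl_mono: "A \<subseteq> B \<Longrightarrow> cl A \<subseteq> cl B"
    and cl_fix: "X \<in> D ` carrier L \<Longrightarrow> cl X = X"
begin

lemma D_eq_iff: "x \<in> carrier L \<Longrightarrow> y \<in> carrier L \<Longrightarrow> D x = D y \<longleftrightarrow> x = y"
  using inj_D by (auto dest: inj_onD)

lemma greatest_Int:
  assumes "x \<in> carrier L" "y \<in> carrier L" "m \<in> carrier L" "D m = D x \<inter> D y"
  shows "greatest L m (Lower L {x, y})"
proof -
  have "m \<sqsubseteq>\<^bsub>L\<^esub> x" "m \<sqsubseteq>\<^bsub>L\<^esub> y" using assms by (simp_all add: le_iff)
  moreover have "z \<sqsubseteq>\<^bsub>L\<^esub> m" if "z \<in> carrier L" "z \<sqsubseteq>\<^bsub>L\<^esub> x" "z \<sqsubseteq>\<^bsub>L\<^esub> y" for z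
    using that assms by (simp add: le_iff)
  ultimately show ?thesis using assms unfolding greatest_def Lower_def by blast
qed

lemma least_cl:
  assumes "x \<in> carrier L" "y \<in> carrier L" "s \<in> carrier L" "D s = cl (D x \<union> D y)"
  shows "least L s (Upper L {x, y})"
proof -
  have "x \<sqsubseteq>\<^bsub>L\<^esub> s" "y \<sqsubseteq>\<^bsub>L\<^esub> s"
    using assms cl_upper[of "D x \<union> D y"] by (simp_all add: le_iff)
  moreover have "s \<sqsubseteq>\<^bsub>L\<^esub> z" if "z \<in> carrier L" "x \<sqsubseteq>\<^bsub>L\<^esub> z" "y \<sqsubseteq>\<^bsub>L\<^esub> z" for z
    using that assms cl_mono[of "D x \<union> D y" "D z"] cl_fix[of "D z"] by (simp add: le_iff)
  ultimately show ?thesis using assms unfolding least_def Upper_def by blast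
qed

sublocale lattice L
proof unfold_locales
  show "x \<sqsubseteq>\<^bsub>L\<^esub> x" if "x \<in> carrier L" for x
    using that by (simp add: le_iff)
  show "x .=\<^bsub>L\<^esub> y" if "x \<sqsubseteq>\<^bsub>L\<^esub> y" "y \<sqsubseteq>\<^bsub>L\<^esub> x" "x \<in> carrier L" "y \<in> carrier L" for x y
    using that by (auto simp: le_iff eq_L D_eq_iff[symmetric])
  show "x \<sqsubseteq>\<^bsub>L\<^esub> z" if "x \<sqsubseteq>\<^bsub>L\<^esub> y" "y \<sqsubseteq>\<^bsub>L\<^esub> z" "x \<in> carrier L" "y \<in> carrier L" "z \<in> carrier L" for x y z
    using that by (auto simp: le_iff)
  show "\<exists>s. least L s (Upper L {x, y})" if "x \<in> carrier L" "y \<in> carrier L" for x y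
    using least_cl[OF that] cl_closed[of "D x" "D y"] that by (force)
  show "\<exists>m. greatest L m (Lower L {x, y})" if "x \<in> carrier L" "y \<in> carrier L" for x y
    using greatest_Int[OF that] Int_closed[of "D x" "D y"] that by (force)
qed (auto simp: eq_L)

lemma D_meet:
  assumes "x \<in> carrier L" "y \<in> carrier L"
  shows "D (x \<sqinter>\<^bsub>L\<^esub> y) = D x \<inter> D y"
proof -
  obtain m where m: "m \<in> carrier L" "D m = D x \<inter> D y"
    using Int_closed[of "D x" "D y"] assms by (force)
  have "D m \<subseteq> D (x \<sqinter>\<^bsub>L\<^esub> y)"
    using meet_le[of m x y] m assms by (auto simp: le_iff)
  moreover have "D (x \<sqinter>\<^bsub>L\<^esub> y) \<subseteq> D x" "D (x \<sqinter>\<^bsub>L\<^esub> y) \<subseteq> D y"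
    using meet_left[of x y] meet_right[of x y] assms by (simp_all add: le_iff)
  ultimately show ?thesis using m by auto
qed

text \<open>An element representing \<open>cl (D x \<union> D y)\<close> is an upper bound, so it
  contains the join. Conversely, the join contains both sets and is fixed by
  \<open>cl\<close>.\<close>

lemma D_join:
  assumes "x \<in> carrier L" "y \<in> carrier L"
  shows "D (x \<squnion>\<^bsub>L\<^esub> y) = cl (D x \<union> D y)"
proof -
  obtain s where s: "s \<in> carrier L" "D s = cl (D x \<union> D y)"
    using cl_closed[of "D x" "D y"] assms by (force)
  have "D (x \<squnion>\<^bsub>L\<^esub> y) \<subseteq> D s"
    using join_le[of x s y] s assms cl_upper[of "D x \<union> D y"] by (auto simp: le_iff)
  moreover have "D x \<union> D y \<subseteq> D (x \<squnion>\<^bsub>L\<^esub> y)"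
    using join_left[of x y] join_right[of x y] assms by (simp add: le_iff)
  then have "cl (D x \<union> D y) \<subseteq> D (x \<squnion>\<^bsub>L\<^esub> y)"
    using cl_mono[of "D x \<union> D y" "D (x \<squnion>\<^bsub>L\<^esub> y)"] cl_fix[of "D (x \<squnion>\<^bsub>L\<^esub> y)"] assms by auto
  ultimately show ?thesis using s by auto
qed

lemma join_absorb: "x \<in> carrier L \<Longrightarrow> y \<in> carrier L \<Longrightarrow> x \<sqsubseteq>\<^bsub>L\<^esub> y \<Longrightarrow> x \<squnion>\<^bsub>L\<^esub> y = y"
  by (simp add: D_eq_iff[symmetric] D_join le_iff cl_fix Un_absorb1)

lemma meet_absorb: "x \<in> carrier L \<Longrightarrow> y \<in> carrier L \<Longrightarrow> x \<sqsubseteq>\<^bsub>L\<^esub> y \<Longrightarrow> x \<sqinter>\<^bsub>L\<^esub> y = x"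
  by (simp add: D_eq_iff[symmetric] D_meet le_iff Int_absorb2)

end


section \<open>Congruences and forcing\<close>

text \<open>\<open>J p\<close> is the join-irreducible element belonging to the label \<open>p\<close> and \<open>K p\<close> is its lower cover.
  The assumption \<open>local\<close> makes every up-set of labels contractible, and \<open>forcing\<close> says that the
  labels contracted by a congruence form an up-set.\<close>

locale labelled_set_lattice = set_lattice L D cl
  for L :: "('a, 'b) gorder_scheme" and D :: "'a \<Rightarrow> 'p set" and cl :: "'p set \<Rightarrow> 'p set" +
  fixes Q :: "('p, 'c) gorder_scheme" and J K :: "'p \<Rightarrow> 'a"
  assumes finite_labels: "finite (carrier Q)"
    and D_subset: "x \<in> carrier L \<Longrightarrow> D x \<subseteq> carrier Q"
    and J_closed: "p \<in> carrier Q \<Longrightarrow> J p \<in> carrier L"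
    and K_closed: "p \<in> carrier Q \<Longrightarrow> K p \<in> carrier L"
    and mem_D_J: "p \<in> carrier Q \<Longrightarrow> p \<in> D (J p)"
    and D_K: "p \<in> carrier Q \<Longrightarrow> D (K p) = D (J p) - {p}"
    and D_J_least: "x \<in> carrier L \<Longrightarrow> p \<in> D x \<Longrightarrow> D (J p) \<subseteq> D x"
    and local: "A \<subseteq> carrier Q \<Longrightarrow> order_ideal Q N \<Longrightarrow> cl A \<inter> N \<subseteq> cl (A \<inter> N)"
    and forcing: "p \<in> carrier Q \<Longrightarrow> q \<in> carrier Q \<Longrightarrow> p \<sqsubseteq>\<^bsub>Q\<^esub> q \<Longrightarrow>
      (\<lambda>p q. p \<in> carrier Q \<and> q \<in> carrier Q \<and>
        (\<exists>z\<in>carrier L. q \<in> cl (D (J p) \<union> D z) \<and> q \<notin> cl (D (K p) \<union> D z)))\<^sup>*\<^sup>* p q"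
begin

section \<open>Contracted labels and the congruence of an up-set\<close>

definition contracted :: "'a rel \<Rightarrow> 'p set" where
  "contracted r = {p \<in> carrier Q. (K p, J p) \<in> r}"

definition contraction :: "'p set \<Rightarrow> 'a rel" where
  "contraction U = {(x, y). x \<in> carrier L \<and> y \<in> carrier L \<and> D x - U = D y - U}"

text \<open>Ideals of the inverse order are up-sets, and their complements are the down-sets that
  \<open>local\<close> speaks about.\<close>

lemma order_ideal_compl:
  assumes "order_ideal (inv_gorder Q) U"
  shows "order_ideal Q (carrier Q - U)"
  using assms by (auto simp: order_ideal_def)

lemma K_le_J: "p \<in> carrier Q \<Longrightarrow> K p \<sqsubseteq>\<^bsub>L\<^esub> J p"
  by (auto simp: le_iff J_closed K_closed D_K)

lemma congruenceD:
  assumes "lattice_congruence L r"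
  shows "equiv (carrier L) r"
    and "(x, y) \<in> r \<Longrightarrow> x \<in> carrier L \<and> y \<in> carrier L"
    and "x \<in> carrier L \<Longrightarrow> (x, x) \<in> r"
    and "(x, y) \<in> r \<Longrightarrow> (y, x) \<in> r"
    and "(x, y) \<in> r \<Longrightarrow> (y, z) \<in> r \<Longrightarrow> (x, z) \<in> r"
    and "(x, x') \<in> r \<Longrightarrow> (y, y') \<in> r \<Longrightarrow> (x \<sqinter>\<^bsub>L\<^esub> y, x' \<sqinter>\<^bsub>L\<^esub> y') \<in> r"
    and "(x, x') \<in> r \<Longrightarrow> (y, y') \<in> r \<Longrightarrow> (x \<squnion>\<^bsub>L\<^esub> y, x' \<squnion>\<^bsub>L\<^esub> y') \<in> r"
proof -
  show e: "equiv (carrier L) r" using assms by (simp add: lattice_congruence_def)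
  show "(x, y) \<in> r \<Longrightarrow> x \<in> carrier L \<and> y \<in> carrier L"
    using e by (auto simp: equiv_def refl_on_def)
  show "x \<in> carrier L \<Longrightarrow> (x, x) \<in> r" using e by (auto simp: equiv_def refl_on_def)
  show "(x, y) \<in> r \<Longrightarrow> (y, x) \<in> r" using e by (auto simp: equiv_def sym_def)
  show "(x, y) \<in> r \<Longrightarrow> (y, z) \<in> r \<Longrightarrow> (x, z) \<in> r"
    using e by (auto simp: equiv_def elim: transE)
qed (use assms in \<open>auto simp: lattice_congruence_def\<close>)

text \<open>Meets are intersections, so they respect equality outside \<open>U\<close>. For joins,
  \<open>local\<close> shows that the part of a join outside \<open>U\<close> is generated by the
  parts of the two arguments outside \<open>U\<close>.\<close>

lemma contraction_congruence:
  assumes U: "order_ideal (inv_gorder Q) U"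
  shows "lattice_congruence L (contraction U)"
proof -
  let ?N = "carrier Q - U"
  have join: "cl (D x \<union> D y) - U \<subseteq> cl (D x' \<union> D y') - U"
    if "x \<in> carrier L" "x' \<in> carrier L" "D x - U = D x' - U"
      "y \<in> carrier L" "y' \<in> carrier L" "D y - U = D y' - U" for x x' y y'
  proof -
    have sub: "D x \<union> D y \<subseteq> carrier Q" using that D_subset by blast
    have "cl (D x \<union> D y) \<subseteq> carrier Q"
      using D_join[of x y] D_subset[of "x \<squnion>\<^bsub>L\<^esub> y"] that by simp
    then have "cl (D x \<union> D y) - U \<subseteq> cl (D x \<union> D y) \<inter> ?N" by blast
    also have "\<dots> \<subseteq> cl ((D x \<union> D y) \<inter> ?N)"
      using local[OF sub order_ideal_compl[OF U]] .
    also have "\<dots> \<subseteq> cl (D x' \<union> D y')"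
      using that by (intro cl_mono) blast
    finally show ?thesis by blast
  qed
  have "equiv (carrier L) (contraction U)"
    by (auto simp: equiv_def refl_on_def sym_def trans_def contraction_def)
  moreover have "(x \<sqinter>\<^bsub>L\<^esub> y, x' \<sqinter>\<^bsub>L\<^esub> y') \<in> contraction U \<and> (x \<squnion>\<^bsub>L\<^esub> y, x' \<squnion>\<^bsub>L\<^esub> y') \<in> contraction U"
    if "(x, x') \<in> contraction U" "(y, y') \<in> contraction U" for x x' y y'
    using that join[of x x' y y'] join[of x' x y' y]
    by (auto simp: contraction_def D_meet D_join)
  ultimately show ?thesis by (auto simp: lattice_congruence_def)
qed

text \<open>Joining the pair \<open>(K p, J p)\<close> with \<open>z\<close>, meeting with
  \<open>J q\<close> and joining with \<open>K q\<close> turns it into \<open>(K q, J q)\<close>.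
  Chains of such steps cover the order of \<open>Q\<close> by \<open>forcing\<close>.\<close>

lemma contracted_ideal:
  assumes r: "lattice_congruence L r"
  shows "order_ideal (inv_gorder Q) (contracted r)"
proof -
  note cong = congruenceD[OF r]
  have step': "q \<in> contracted r"
    if p: "p \<in> contracted r" and q: "q \<in> carrier Q" and z: "z \<in> carrier L"
      and in_J: "q \<in> cl (D (J p) \<union> D z)" and notin_K: "q \<notin> cl (D (K p) \<union> D z)" for p q z
  proof -
    have p': "p \<in> carrier Q" "(K p, J p) \<in> r" using p by (auto simp: contracted_def)
    note cl = J_closed[OF p'(1)] K_closed[OF p'(1)] J_closed[OF q] K_closed[OF q] z
    \<comment> \<open>As \<open>q\<close> is missing from the join of \<open>K p\<close> and
      \<open>z\<close>, the element \<open>?m\<close> lies below \<open>J q\<close> and lacks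
      \<open>q\<close>, hence lies below \<open>K q\<close>.\<close>
    let ?m = "J q \<sqinter>\<^bsub>L\<^esub> (K p \<squnion>\<^bsub>L\<^esub> z)"
    have "D (J q) \<subseteq> cl (D (J p) \<union> D z)"
      using D_J_least[of "J p \<squnion>\<^bsub>L\<^esub> z" q] in_J cl by (simp add: D_join)
    then have "J q \<sqinter>\<^bsub>L\<^esub> (J p \<squnion>\<^bsub>L\<^esub> z) = J q"
      using cl by (intro meet_absorb) (auto simp: le_iff D_join)
    moreover have "(?m, J q \<sqinter>\<^bsub>L\<^esub> (J p \<squnion>\<^bsub>L\<^esub> z)) \<in> r"
      using p' cl by (intro cong(6) cong(7) cong(3)) auto
    ultimately have "(K q \<squnion>\<^bsub>L\<^esub> ?m, K q \<squnion>\<^bsub>L\<^esub> J q) \<in> r"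
      using cong(3)[of "K q"] cong(7)[of "K q" "K q" ?m "J q"] cl by simp
    moreover have "?m \<squnion>\<^bsub>L\<^esub> K q = K q"
      using cl notin_K q by (intro join_absorb) (auto simp: le_iff D_meet D_join D_K)
    moreover have "K q \<squnion>\<^bsub>L\<^esub> J q = J q"
      using cl K_le_J[OF q] by (intro join_absorb) auto
    ultimately show ?thesis
      using q by (simp add: contracted_def join_comm)
  qed
  have "q \<in> contracted r"
    if "p \<in> contracted r" "p \<in> carrier Q" "q \<in> carrier Q" "p \<sqsubseteq>\<^bsub>Q\<^esub> q" for p q
    using forcing[OF that(2-4)] that(1)
  proof (induction rule: rtranclp_induct)
    case (step q q')
    then show ?case using step' by blast
  qed
  then show ?thesis
    by (auto simp: order_ideal_def contracted_def)
qed

lemma contracted_contraction: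
  assumes "order_ideal (inv_gorder Q) U"
  shows "contracted (contraction U) = U"
proof -
  have "(K p, J p) \<in> contraction U \<longleftrightarrow> p \<in> U" if "p \<in> carrier Q" for p
    using that mem_D_J[OF that] by (auto simp: contraction_def J_closed K_closed D_K)
  moreover have "U \<subseteq> carrier Q" using assms by (simp add: order_ideal_def)
  ultimately show ?thesis unfolding contracted_def by blast
qed

text \<open>If \<open>p\<close> separates \<open>x\<close> from \<open>y\<close>, meeting the pair
  with \<open>J p\<close> gives \<open>J p\<close> on one side and an element below
  \<open>K p\<close> on the other. Joining with \<open>K p\<close> then contracts
  \<open>p\<close>.\<close>

lemma congruence_subset_contraction:
  assumes r: "lattice_congruence L r"
  shows "r \<subseteq> contraction (contracted r)"
proof -
  note cong = congruenceD[OF r]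
  have sub: "D x - contracted r \<subseteq> D y" if xy: "(x, y) \<in> r" for x y
  proof (rule subsetI, rule ccontr)
    fix p assume p: "p \<in> D x - contracted r" and py: "p \<notin> D y"
    have x: "x \<in> carrier L" and y: "y \<in> carrier L" using cong(2)[OF xy] by auto
    have pQ: "p \<in> carrier Q" using D_subset[OF x] p by blast
    note cl = J_closed[OF pQ] K_closed[OF pQ] x y
    let ?m = "J p \<sqinter>\<^bsub>L\<^esub> y"
    have "J p \<sqinter>\<^bsub>L\<^esub> x = J p"
      using cl p D_J_least[of x p] by (intro meet_absorb) (auto simp: le_iff)
    then have "(?m, J p) \<in> r"
      using cong(6)[OF cong(3)[of "J p"] cong(4)[OF xy]] cl by simp
    then have "(K p \<squnion>\<^bsub>L\<^esub> ?m, K p \<squnion>\<^bsub>L\<^esub> J p) \<in> r"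
      using cong(3)[of "K p"] cong(7)[of "K p" "K p" ?m "J p"] cl by simp
    moreover have "?m \<squnion>\<^bsub>L\<^esub> K p = K p"
      using cl py pQ by (intro join_absorb) (auto simp: le_iff D_meet D_K)
    moreover have "K p \<squnion>\<^bsub>L\<^esub> J p = J p"
      using cl K_le_J[OF pQ] by (intro join_absorb) auto
    ultimately have "p \<in> contracted r"
      using pQ by (simp add: contracted_def join_comm)
    then show False using p by blast
  qed
  show ?thesis
  proof (rule subrelI)
    fix x y assume xy: "(x, y) \<in> r"
    show "(x, y) \<in> contraction (contracted r)"
      using sub[OF xy] sub[OF cong(4)[OF xy]] cong(2)[OF xy] by (auto simp: contraction_def)
  qed
qed

text \<open>Climb from \<open>z\<close> to \<open>x\<close>: joining \<open>z\<close> with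
  \<open>J p\<close> for a suitable missing label \<open>p\<close> stays in the class of
  \<open>z\<close>, stays below \<open>x\<close> and leaves fewer labels missing.\<close>

lemma congruent_below:
  assumes r: "lattice_congruence L r"
    and "z \<in> carrier L" "x \<in> carrier L" "D z \<subseteq> D x" "D x - D z \<subseteq> contracted r"
  shows "(z, x) \<in> r"
  using assms(2-)
proof (induction "card (D x - D z)" arbitrary: z rule: less_induct)
  case less
  note cong = congruenceD[OF r]
  show ?case
  proof (cases "D x = D z")
    case True
    then show ?thesis using less.prems cong(3)[of x] D_eq_iff[of x z] by simp
  next
    case False
    obtain p' where "p' \<in> D x - D z" using False less.prems by blast
    \<comment> \<open>Minimality forces \<open>K p\<close> below \<open>z\<close>: a missing label
      \<open>q\<close> of \<open>K p\<close> would have \<open>D (J q)\<close> inside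
      \<open>D (K p)\<close>, which is smaller than \<open>D (J p)\<close>.\<close>
    then obtain p where p: "p \<in> D x - D z"
      and min: "\<And>q. q \<in> D x - D z \<Longrightarrow> card (D (J p)) \<le> card (D (J q))"
      using ex_has_least_nat[of "\<lambda>p. p \<in> D x - D z" p' "\<lambda>p. card (D (J p))"] by blast
    have pQ: "p \<in> carrier Q" using p D_subset less.prems by blast
    note cl = J_closed[OF pQ] K_closed[OF pQ] less.prems(1,2)
    have fin: "finite (D y)" if "y \<in> carrier L" for y
      using finite_subset[OF D_subset[OF that] finite_labels] .
    have "D (K p) \<subseteq> D z"
    proof (rule ccontr)
      assume "\<not> D (K p) \<subseteq> D z"
      then obtain q where q: "q \<in> D (K p)" "q \<notin> D z" by blast
      have "D (J p) \<subseteq> D x" using D_J_least[of x p] p less.prems by blast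
      then have "q \<in> D x - D z" using q D_K[OF pQ] by blast
      then have "card (D (J p)) \<le> card (D (J q))" by (rule min)
      also have "\<dots> \<le> card (D (K p))"
        using D_J_least[OF cl(2) q(1)] fin[OF cl(2)] by (intro card_mono)
      also have "\<dots> < card (D (J p))"
        unfolding D_K[OF pQ] using mem_D_J[OF pQ] fin[OF cl(1)] by (intro card_Diff1_less)
      finally show False by simp
    qed
    then have "K p \<squnion>\<^bsub>L\<^esub> z = z" using cl by (intro join_absorb) (auto simp: le_iff)
    moreover have "(K p \<squnion>\<^bsub>L\<^esub> z, J p \<squnion>\<^bsub>L\<^esub> z) \<in> r"
      using p less.prems cong(7)[OF _ cong(3)[OF cl(3)], of "K p" "J p"]
      unfolding contracted_def by blast
    ultimately have zw: "(z, J p \<squnion>\<^bsub>L\<^esub> z) \<in> r" by simp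
    have "J p \<squnion>\<^bsub>L\<^esub> z \<sqsubseteq>\<^bsub>L\<^esub> x"
      using cl p D_J_least[of x p] less.prems by (intro join_le) (auto simp: le_iff)
    then have wx: "D (J p \<squnion>\<^bsub>L\<^esub> z) \<subseteq> D x" using cl by (simp add: le_iff)
    have zw': "insert p (D z) \<subseteq> D (J p \<squnion>\<^bsub>L\<^esub> z)"
      using cl cl_upper[of "D (J p) \<union> D z"] mem_D_J[OF pQ] by (auto simp: D_join)
    have "card (D x - D (J p \<squnion>\<^bsub>L\<^esub> z)) < card (D x - D z)"
      using zw' p fin[OF cl(4)] by (intro psubset_card_mono) auto
    then have "(J p \<squnion>\<^bsub>L\<^esub> z, x) \<in> r"
    proof (rule less.hyps)
      show "J p \<squnion>\<^bsub>L\<^esub> z \<in> carrier L" using cl by simp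
    qed (use less.prems wx zw' in blast)+
    then show ?thesis by (rule cong(5)[OF zw])
  qed
qed

lemma contraction_contracted:
  assumes r: "lattice_congruence L r"
  shows "contraction (contracted r) = r"
proof
  note cong = congruenceD[OF r]
  show "contraction (contracted r) \<subseteq> r"
  proof (rule subrelI)
    fix x y assume "(x, y) \<in> contraction (contracted r)"
    then have xy: "x \<in> carrier L" "y \<in> carrier L" "D x - contracted r = D y - contracted r"
      by (auto simp: contraction_def)
    \<comment> \<open>The meet serves as a common lower element: \<open>x\<close> and
      \<open>y\<close> each exceed it by contracted labels only.\<close>
    have "(x \<sqinter>\<^bsub>L\<^esub> y, x) \<in> r" "(x \<sqinter>\<^bsub>L\<^esub> y, y) \<in> r"
      by (rule congruent_below[OF r]; use xy in \<open>auto simp: D_meet\<close>)+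
    then show "(x, y) \<in> r" by (metis cong(4) cong(5))
  qed
qed (rule congruence_subset_contraction[OF r])

theorem congruence_lattice_isomorphic:
  "order_isomorphic (congruence_lattice L) (ideal_lattice (inv_gorder Q))"
  unfolding order_isomorphic_def
proof (intro exI conjI ballI)
  have "contracted r \<subseteq> contracted s \<longleftrightarrow> r \<subseteq> s"
    if "lattice_congruence L r" "lattice_congruence L s" for r s
  proof
    assume "contracted r \<subseteq> contracted s"
    then have "contraction (contracted r) \<subseteq> contraction (contracted s)"
      by (auto simp: contraction_def)
    then show "r \<subseteq> s" using that by (simp add: contraction_contracted)
  qed (auto simp: contracted_def)
  then show "r \<sqsubseteq>\<^bsub>congruence_lattice L\<^esub> s \<longleftrightarrow>
      contracted r \<sqsubseteq>\<^bsub>ideal_lattice (inv_gorder Q)\<^esub> contracted s"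
    if "r \<in> carrier (congruence_lattice L)" "s \<in> carrier (congruence_lattice L)" for r s
    using that by (simp add: congruence_lattice_def ideal_lattice_def)
  show "bij_betw contracted (carrier (congruence_lattice L))
      (carrier (ideal_lattice (inv_gorder Q)))"
  proof (rule bij_betw_byWitness[where f' = contraction])
    show "\<forall>r\<in>carrier (congruence_lattice L). contraction (contracted r) = r"
      by (simp add: congruence_lattice_def contraction_contracted)
    show "\<forall>U\<in>carrier (ideal_lattice (inv_gorder Q)). contracted (contraction U) = U"
      by (simp add: ideal_lattice_def contracted_contraction)
    show "contracted ` carrier (congruence_lattice L) \<subseteq> carrier (ideal_lattice (inv_gorder Q))"
      using contracted_ideal by (simp add: congruence_lattice_def ideal_lattice_def image_subset_iff)
    show "contraction ` carrier (ideal_lattice (inv_gorder Q)) \<subseteq> carrier (congruence_lattice L)"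
      using contraction_congruence
      by (simp add: congruence_lattice_def ideal_lattice_def image_subset_iff)
  qed
qed

end


section \<open>Tableaux without arrows\<close>

text \<open>One condition covers both halves of the definition: in row 1 the truncated bound reads
  \<open>0 \<le> j\<close>.\<close>

lemma board_iff: "(i, j) \<in> board n \<longleftrightarrow> 1 \<le> i \<and> i \<le> n \<and> i - 1 \<le> j \<and> 1 \<le> j \<and> j \<le> n"
  by (auto simp: board_def)

lemma fb_tableau_cell:
  assumes "fb_tableau n T" "(i, j) \<in> T"
  shows "1 \<le> i" "i \<le> n" "i - 1 \<le> j" "1 \<le> j" "j \<le> n"
proof -
  have "(i, j) \<in> board n" using assms by (auto simp: fb_tableau_def)
  then show "1 \<le> i" "i \<le> n" "i - 1 \<le> j" "1 \<le> j" "j \<le> n" by (simp_all add: board_iff)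
qed

lemma fb_tableau_root: "fb_tableau n T \<Longrightarrow> (1, n) \<in> T"
  by (simp add: fb_tableau_def root_def)

lemma fb_tableau_border: "fb_tableau n T \<Longrightarrow> 1 \<le> i \<Longrightarrow> i < n \<Longrightarrow> (Suc i, i) \<in> T"
  by (force simp: fb_tableau_def border_def)

lemma fb_tableau_parent:
  assumes "fb_tableau n T" "(i, j) \<in> T" "(i, j) \<noteq> (1, n)"
  shows "(\<exists>k>j. (i, k) \<in> T) \<or> (\<exists>u<i. (u, j) \<in> T)"
  using assms by (fastforce simp: fb_tableau_def root_def left_of_def above_def)

text \<open>The topmost nonempty cell of a column is an up-arrow or the root. This lemma and
  \<open>leftmost_cell\<close> replace arrows by arbitrary nonempty cells in the descriptions of
  \<open>Col\<close>, \<open>Row\<close> and free cells.\<close>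

lemma topmost_cell:
  fixes T :: "cell set"
  assumes "(u, j) \<in> T"
  obtains u' where "u' \<le> u" "(u', j) \<in> T" "\<forall>v<u'. (v, j) \<notin> T"
proof -
  define u' where "u' = (LEAST v. (v, j) \<in> T)"
  have "(u', j) \<in> T" unfolding u'_def by (rule LeastI[of "\<lambda>v. (v, j) \<in> T", OF assms])
  moreover have "u' \<le> u" unfolding u'_def by (rule Least_le[of "\<lambda>v. (v, j) \<in> T", OF assms])
  moreover have "\<forall>v<u'. (v, j) \<notin> T" unfolding u'_def using not_less_Least by blast
  ultimately show ?thesis using that by blast
qed

lemma leftmost_cell:
  assumes "fb_tableau n T" "(i, k) \<in> T"
  obtains k' where "k \<le> k'" "(i, k') \<in> T" "\<forall>m>k'. (i, m) \<notin> T"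
proof -
  define k' where "k' = (GREATEST m. (i, m) \<in> T)"
  have bound: "\<And>m. (i, m) \<in> T \<Longrightarrow> m \<le> n" using fb_tableau_cell(5)[OF assms(1)] .
  have "(i, k') \<in> T" unfolding k'_def 
    using GreatestI_nat[of "\<lambda>m. (i, m) \<in> T", OF assms(2)] bound by blast
  moreover have le: "\<And>m. (i, m) \<in> T \<Longrightarrow> m \<le> k'"
    unfolding k'_def using Greatest_le_nat[of "\<lambda>m. (i, m) \<in> T"] bound by blast
  ultimately show ?thesis using that[of k'] assms(2) by force
qed

lemma up_arrows_iff:
  "(i, j) \<in> up_arrows n T \<longleftrightarrow> (i, j) \<in> T \<and> (i, j) \<noteq> (1, n) \<and> (\<forall>u<i. (u, j) \<notin> T)"
  by (auto simp: up_arrows_def above_def root_def)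

lemma left_arrows_iff:
  "(i, j) \<in> left_arrows n T \<longleftrightarrow> (i, j) \<in> T \<and> (i, j) \<noteq> (1, n) \<and> (\<forall>k>j. (i, k) \<notin> T)"
  by (auto simp: left_arrows_def left_of_def root_def)

lemma Col_iff:
  assumes T: "fb_tableau n T"
  shows "(i, j) \<in> Col n T \<longleftrightarrow> (i, j) \<in> board n \<and> (\<exists>u\<le>i. (u, j) \<in> T)"
proof -
  have "(i, j) \<in> Col n T \<longleftrightarrow> (i, j) \<in> board n \<and>
      (\<exists>u\<le>i. (u, j) = (1, n) \<or> (u, j) \<in> up_arrows n T)"
    by (fastforce simp: Col_def above_def root_def le_less)
  moreover have "(u, j) = (1, n) \<or> (u, j) \<in> up_arrows n T \<Longrightarrow> (u, j) \<in> T" for u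
    using fb_tableau_root[OF T] by (auto simp: up_arrows_iff)
  moreover have "\<exists>u\<le>i. (u, j) = (1, n) \<or> (u, j) \<in> up_arrows n T" if u: "(u, j) \<in> T" "u \<le> i" for u
  proof -
    obtain u' where "u' \<le> u" "(u', j) \<in> T" "\<forall>v<u'. (v, j) \<notin> T"
      using topmost_cell[OF u(1)] .
    then show ?thesis using u(2) by (intro exI[of _ u']) (simp add: up_arrows_iff)
  qed
  ultimately show ?thesis by blast
qed

lemma Row_iff:
  assumes T: "fb_tableau n T"
  shows "(i, j) \<in> Row n T \<longleftrightarrow> (i, j) \<in> board n \<and> (\<exists>k\<ge>j. (i, k) \<in> T)"
proof -
  have "(i, j) \<in> Row n T \<longleftrightarrow> (i, j) \<in> board n \<and>
      (\<exists>k\<ge>j. (i, k) = (1, n) \<or> (i, k) \<in> left_arrows n T)"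
    by (fastforce simp: Row_def left_of_def root_def le_less)
  moreover have "(i, k) = (1, n) \<or> (i, k) \<in> left_arrows n T \<Longrightarrow> (i, k) \<in> T" for k
    using fb_tableau_root[OF T] by (auto simp: left_arrows_iff)
  moreover have "\<exists>k\<ge>j. (i, k) = (1, n) \<or> (i, k) \<in> left_arrows n T" if k: "(i, k) \<in> T" "j \<le> k" for k
  proof -
    obtain k' where "k \<le> k'" "(i, k') \<in> T" "\<forall>m>k'. (i, m) \<notin> T"
      using leftmost_cell[OF T k(1)] .
    then show ?thesis using k(2) by (intro exI[of _ k']) (simp add: left_arrows_iff)
  qed
  ultimately show ?thesis by blast
qed

lemma free_cells_iff:
  assumes T: "fb_tableau n T"
  shows "(i, j) \<in> free_cells n T \<longleftrightarrow>
    (i, j) \<in> board n \<and> (\<exists>u<i. (u, j) \<in> T) \<and> (\<exists>k>j. (i, k) \<in> T)"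
proof
  assume "(i, j) \<in> free_cells n T"
  then show "(i, j) \<in> board n \<and> (\<exists>u<i. (u, j) \<in> T) \<and> (\<exists>k>j. (i, k) \<in> T)"
    by (fastforce simp: free_cells_def up_arrows_def left_arrows_def above_def left_of_def)
next
  assume *: "(i, j) \<in> board n \<and> (\<exists>u<i. (u, j) \<in> T) \<and> (\<exists>k>j. (i, k) \<in> T)"
  then obtain u k where u: "u < i" "(u, j) \<in> T" and k: "j < k" "(i, k) \<in> T" by blast
  obtain u' where u': "u' \<le> u" "(u', j) \<in> T" "\<forall>v<u'. (v, j) \<notin> T"
    using topmost_cell[OF u(2)] .
  obtain k' where k': "k \<le> k'" "(i, k') \<in> T" "\<forall>m>k'. (i, m) \<notin> T"
    using leftmost_cell[OF T k(2)] .
  \<comment> \<open>The bounds \<open>j < n\<close> and \<open>1 < i\<close> ensure that the topmost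
    and the leftmost cell found are not the root, hence are arrows.\<close>
  have "j < n" using fb_tableau_cell[OF T k(2)] k by linarith
  moreover have "1 < i" using fb_tableau_cell[OF T u(2)] u by linarith
  ultimately have "(u', j) \<in> up_arrows n T" "(i, k') \<in> left_arrows n T"
    using u' k' by (simp_all add: up_arrows_iff left_arrows_iff)
  moreover have "above (u', j) (i, j)" "left_of (i, k') (i, j)"
    using u u' k k' by (simp_all add: above_def left_of_def)
  ultimately show "(i, j) \<in> free_cells n T"
    using * unfolding free_cells_def by blast
qed

text \<open>A free cell has nonempty cells above it and to its left, so it is no arrow once it is
  nonempty.\<close>

lemma free_dots_iff:
  assumes "fb_tableau n T" "c \<in> free_cells n T"
  shows "c \<in> dots n T \<longleftrightarrow> c \<in> T"
  using assms(2)
  by (fastforce simp: free_cells_def dots_def up_arrows_def left_arrows_def)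

lemma fb_le_iff:
  assumes "fb_tableau n S" "fb_tableau n T"
  shows "fb_le n S T \<longleftrightarrow> Col n S \<subseteq> Col n T \<and> Row n T \<subseteq> Row n S \<and>
    free_cells n S \<inter> free_cells n T \<inter> S \<subseteq> T"
  using free_dots_iff[OF assms(1)] free_dots_iff[OF assms(2)] unfolding fb_le_def by blast

text \<open>\<open>Col\<close> at the cell above and \<open>Row\<close> at the cell to the left tell
  whether anything nonempty lies strictly above or to the left. If one of these is missing, the cell
  is decided by \<open>Col\<close> or \<open>Row\<close> at the cell itself; otherwise it is
  free.\<close>

lemma fb_tableau_eqI:
  assumes ST: "fb_tableau n S" "fb_tableau n T"
    and "Col n S = Col n T" "Row n S = Row n T"
    and "free_cells n S \<inter> free_cells n T \<inter> S \<subseteq> T"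
  shows "S \<subseteq> T"
proof (rule subrelI)
  fix i j assume c: "(i, j) \<in> S"
  have b: "(i, j) \<in> board n" using c ST by (auto simp: fb_tableau_def)
  note bounds = fb_tableau_cell[OF ST(1) c]
  have col: "(\<exists>u\<le>i. (u, j) \<in> S) \<longleftrightarrow> (\<exists>u\<le>i. (u, j) \<in> T)" if "(i, j) \<in> board n" for i
    using that assms(3) Col_iff[OF ST(1), of i j] Col_iff[OF ST(2), of i j] by blast
  have row: "(\<exists>k\<ge>j. (i, k) \<in> S) \<longleftrightarrow> (\<exists>k\<ge>j. (i, k) \<in> T)" if "(i, j) \<in> board n" for j
    using that assms(4) Row_iff[OF ST(1), of i j] Row_iff[OF ST(2), of i j] by blast
  have above: "(\<exists>u<i. (u, j) \<in> S) \<longleftrightarrow> (\<exists>u<i. (u, j) \<in> T)"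
  proof (cases "i = 1")
    case True
    then show ?thesis using fb_tableau_cell(1)[OF ST(1)] fb_tableau_cell(1)[OF ST(2)] by force
  next
    case False
    then have "(i - 1, j) \<in> board n" "\<And>u. u < i \<longleftrightarrow> u \<le> i - 1" using bounds by (auto simp: board_iff)
    then show ?thesis using col[of "i - 1"] by simp
  qed
  have left: "(\<exists>k>j. (i, k) \<in> S) \<longleftrightarrow> (\<exists>k>j. (i, k) \<in> T)"
  proof (cases "j = n")
    case True
    then show ?thesis using fb_tableau_cell(5)[OF ST(1)] fb_tableau_cell(5)[OF ST(2)] by force
  next
    case False
    then have "(i, Suc j) \<in> board n" using bounds by (auto simp: board_iff)
    then show ?thesis using row[of "Suc j"] by (simp add: Suc_le_eq)
  qed
  show "(i, j) \<in> T"
  proof (cases "(\<exists>u<i. (u, j) \<in> S) \<and> (\<exists>k>j. (i, k) \<in> S)")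
    case True
    then have "(i, j) \<in> free_cells n S" "(i, j) \<in> free_cells n T"
      using above left b by (simp_all add: free_cells_iff[OF ST(1)] free_cells_iff[OF ST(2)])
    then show ?thesis using assms(5) c by blast
  next
    case False
    then show ?thesis
      using above left col[OF b] row[OF b] c by (metis le_less)
  qed
qed

lemma fb_le_antisym:
  assumes "fb_tableau n S" "fb_tableau n T" "fb_le n S T" "fb_le n T S"
  shows "S = T"
proof
  note le = assms(3)[unfolded fb_le_iff[OF assms(1,2)]] assms(4)[unfolded fb_le_iff[OF assms(2,1)]]
  show "S \<subseteq> T" by (rule fb_tableau_eqI[OF assms(1,2)]; use le in blast)
  show "T \<subseteq> S" by (rule fb_tableau_eqI[OF assms(2,1)]; use le in blast)
qed


section \<open>Tableaux as sets of colored intervals\<close>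

text \<open>The interval \<open>[i, j]\<close> stands for the cell \<open>(i + 1, j)\<close>. Through its colored copies green, blue,
  red that lie in \<open>encode n T\<close>, the cell carries one of four values, in increasing order:
  not strictly below an up-arrow; free and empty; free with a dot; strictly below an up-arrow and
  weakly to the left of the left-arrow of its row. On the diagonal the cell is never empty, so there
  is no blue interval.\<close>

fun holds :: "cell set \<Rightarrow> colored_interval \<Rightarrow> bool" where
  "holds T (CI i j Green) \<longleftrightarrow> (\<exists>u\<le>i. (u, j) \<in> T)"
| "holds T (CI i j Blue) \<longleftrightarrow> (\<exists>u\<le>i. (u, j) \<in> T) \<and> ((\<forall>k>j. (Suc i, k) \<notin> T) \<or> (Suc i, j) \<in> T)"
| "holds T (CI i j Red) \<longleftrightarrow> (\<exists>u\<le>i. (u, j) \<in> T) \<and> (\<forall>k>j. (Suc i, k) \<notin> T)"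

definition encode :: "nat \<Rightarrow> cell set \<Rightarrow> colored_interval set" where
  "encode n T = {p \<in> colored_intervals n. holds T p}"

lemma colored_intervals_iff:
  "CI i j s \<in> colored_intervals n \<longleftrightarrow> 1 \<le> i \<and> i \<le> j \<and> j < n \<and> (s = Blue \<longrightarrow> i < j)"
  by (cases s) (auto simp: colored_intervals_def)

text \<open>The three conditions of the order yield the green, red and blue intervals in
  turn.\<close>

lemma fb_le_encode:
  assumes ST: "fb_tableau n S" "fb_tableau n T" and le: "fb_le n S T"
  shows "encode n S \<subseteq> encode n T"
proof
  fix p assume p: "p \<in> encode n S"
  obtain i j s where p_eq: "p = CI i j s" by (cases p)
  have ij: "1 \<le> i" "i \<le> j" "j < n" "s = Blue \<Longrightarrow> i < j"
    using p by (auto simp: encode_def p_eq colored_intervals_iff)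
  note le' = le[unfolded fb_le_iff[OF ST]]
  have green: "\<exists>u\<le>i. (u, j) \<in> T" if "\<exists>u\<le>i. (u, j) \<in> S"
  proof -
    have "(i, j) \<in> Col n S" using that ij by (simp add: Col_iff[OF ST(1)] board_iff)
    then show ?thesis using le' Col_iff[OF ST(2), of i j] by blast
  qed
  have red: "\<forall>k>j. (Suc i, k) \<notin> T" if "\<forall>k>j. (Suc i, k) \<notin> S"
  proof -
    \<comment> \<open>Nothing lies strictly to the left of column \<open>j\<close> exactly when the
      neighbouring cell in column \<open>Suc j\<close> is outside \<open>Row\<close>;
      \<open>i \<le> j < n\<close> puts that cell on the board.\<close>
    have b: "(Suc i, Suc j) \<in> board n" using ij by (simp add: board_iff)
    have "(Suc i, Suc j) \<notin> Row n S" using that by (simp add: Row_iff[OF ST(1)] Suc_le_eq)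
    then have "(Suc i, Suc j) \<notin> Row n T" using le' by blast
    then show ?thesis using b by (simp add: Row_iff[OF ST(2)] Suc_le_eq)
  qed
  have blue: "(Suc i, j) \<in> T"
    if "(Suc i, j) \<in> S" "\<exists>u\<le>i. (u, j) \<in> S" "\<not> (\<forall>k>j. (Suc i, k) \<notin> T)"
  proof -
    have "(Suc i, j) \<in> board n" using ij by (simp add: board_iff)
    then have "(Suc i, j) \<in> free_cells n S" "(Suc i, j) \<in> free_cells n T"
      using that green red
      by (auto simp: free_cells_iff[OF ST(1)] free_cells_iff[OF ST(2)] less_Suc_eq_le)
    then show ?thesis using le' that by blast
  qed
  have "holds T p" using p green red blue by (cases s) (auto simp: encode_def p_eq)
  then show "p \<in> encode n T" using p by (simp add: encode_def)
qed

lemma encode_fb_le: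
  assumes ST: "fb_tableau n S" "fb_tableau n T" and sub: "encode n S \<subseteq> encode n T"
  shows "fb_le n S T"
proof -
  have hold: "holds T (CI i j s)" if "holds S (CI i j s)" "1 \<le> i" "i \<le> j" "j < n" "s = Blue \<longrightarrow> i < j"
    for i j s
    using sub that by (auto simp: encode_def colored_intervals_iff subset_iff)
  have "Col n S \<subseteq> Col n T"
  proof (rule subrelI)
    fix i j assume "(i, j) \<in> Col n S"
    then have b: "(i, j) \<in> board n" and S: "\<exists>u\<le>i. (u, j) \<in> S" by (simp_all add: Col_iff[OF ST(1)])
    \<comment> \<open>Green intervals see only the cells with \<open>i \<le> j < n\<close>. The rest
      of the board is column \<open>n\<close> and the border, which lie in \<open>Col\<close> of
      every tableau.\<close>
    have "j = n \<or> j < n \<and> i = Suc j \<or> j < n \<and> i \<le> j"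
      using b unfolding board_iff by arith
    then consider "j = n" | "j < n" "i = Suc j" | "j < n" "i \<le> j" by blast
    then have "\<exists>u\<le>i. (u, j) \<in> T"
    proof cases
      case 1
      then show ?thesis using fb_tableau_root[OF ST(2)] b by (auto simp: board_iff)
    next
      case 2
      then show ?thesis using fb_tableau_border[OF ST(2), of j] b by (auto simp: board_iff)
    next
      case 3
      then show ?thesis using hold[of i j Green] S b by (simp add: board_iff)
    qed
    then show "(i, j) \<in> Col n T" using b by (simp add: Col_iff[OF ST(2)])
  qed
  moreover have "Row n T \<subseteq> Row n S"
  proof (rule subrelI, rule ccontr)
    fix i j assume "(i, j) \<in> Row n T" and "(i, j) \<notin> Row n S"
    then have b: "(i, j) \<in> board n" and T: "\<exists>k\<ge>j. (i, k) \<in> T" and S: "\<forall>k\<ge>j. (i, k) \<notin> S"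
      by (auto simp: Row_iff[OF ST(1)] Row_iff[OF ST(2)])
    have "i \<noteq> 1" using S fb_tableau_root[OF ST(1)] b by (auto simp: board_iff)
    then obtain i' where i: "i = Suc i'" "1 \<le> i'" "i' < n"
      using b by (cases i) (auto simp: board_iff)
    \<comment> \<open>The border cell makes the row nonempty, so it has a leftmost cell, in some
      column \<open>k < j\<close>. Its parent can only be above, which makes \<open>[i', k]\<close>
      red in \<open>S\<close>; carried over to \<open>T\<close>, this excludes nonempty cells from
      column \<open>j\<close> leftwards.\<close>
    have "(i, i') \<in> S" using fb_tableau_border[OF ST(1)] i by simp
    then obtain k where k: "i' \<le> k" "(i, k) \<in> S" "\<forall>m>k. (i, m) \<notin> S"
      by (rule leftmost_cell[OF ST(1)])
    have "k < j" using k(2) S by (meson not_le)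
    have "\<exists>u\<le>i'. (u, k) \<in> S"
      using fb_tableau_parent[OF ST(1) k(2)] k(3) i by (auto simp: less_Suc_eq_le)
    then have "holds T (CI i' k Red)"
      using hold[of i' k Red] k i \<open>k < j\<close> b by (simp add: board_iff)
    then show False using T i \<open>k < j\<close> by auto
  qed
  moreover have "free_cells n S \<inter> free_cells n T \<inter> S \<subseteq> T"
  proof (rule subrelI)
    fix i j assume *: "(i, j) \<in> free_cells n S \<inter> free_cells n T \<inter> S"
    then have b: "(i, j) \<in> board n" and S: "(i, j) \<in> S" "\<exists>u<i. (u, j) \<in> S"
      and T: "\<exists>k>j. (i, k) \<in> T"
      by (auto simp: free_cells_iff[OF ST(1)] free_cells_iff[OF ST(2)])
    have "1 < i" using S(2) fb_tableau_cell(1)[OF ST(1)] by fastforce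
    then obtain i' where i: "i = Suc i'" "1 \<le> i'" by (cases i) auto
    have "j < n" using T fb_tableau_cell(5)[OF ST(2)] by fastforce
    show "(i, j) \<in> T"
    proof (cases "i' < j")
      case True
      then show ?thesis
        using hold[of i' j Blue] S T i \<open>j < n\<close> by (auto simp: less_Suc_eq_le)
    next
      case False
      then have "j = i'" using b i by (simp add: board_iff)
      then show ?thesis using fb_tableau_border[OF ST(2)] i \<open>j < n\<close> by simp
    qed
  qed
  ultimately show ?thesis by (simp add: fb_le_iff[OF ST])
qed

text \<open>The rule concluding Green starts from every color, because Red cannot pass through Blue
  on the diagonal.\<close>

definition closed_set :: "nat \<Rightarrow> colored_interval set \<Rightarrow> bool" where
  "closed_set n X \<longleftrightarrow> X \<subseteq> colored_intervals n \<and>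
    (\<forall>i j s. CI i j s \<in> X \<longrightarrow> CI i j Green \<in> X) \<and>
    (\<forall>i j. CI i j Red \<in> X \<longrightarrow> i < j \<longrightarrow> CI i j Blue \<in> X) \<and>
    (\<forall>i j. CI i j Green \<in> X \<longrightarrow> i < j \<longrightarrow> CI (Suc i) j Green \<in> X) \<and>
    (\<forall>i j k. CI i k Red \<in> X \<longrightarrow> CI (Suc i) j Green \<in> X \<longrightarrow> k < j \<longrightarrow> CI i j Red \<in> X)"

lemma closed_setD:
  assumes "closed_set n X"
  shows "CI i j s \<in> X \<Longrightarrow> 1 \<le> i \<and> i \<le> j \<and> j < n \<and> (s = Blue \<longrightarrow> i < j)"
    and "CI i j s \<in> X \<Longrightarrow> CI i j Green \<in> X"
    and "CI i j Red \<in> X \<Longrightarrow> i < j \<Longrightarrow> CI i j Blue \<in> X"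
    and "CI i j Green \<in> X \<Longrightarrow> i < j \<Longrightarrow> CI (Suc i) j Green \<in> X"
    and "CI i k Red \<in> X \<Longrightarrow> CI (Suc i) j Green \<in> X \<Longrightarrow> k < j \<Longrightarrow> CI i j Red \<in> X"
  using assms unfolding closed_set_def
  by (blast dest: colored_intervals_iff[THEN iffD1] | force simp: colored_intervals_iff)+

lemma closed_set_green_mono:
  assumes "closed_set n X" "CI i j Green \<in> X" "i \<le> i'" "i' \<le> j"
  shows "CI i' j Green \<in> X"
  using assms(3,4)
proof (induction i' rule: dec_induct)
  case (step m)
  then show ?case using closed_setD(4)[OF assms(1), of m j] by simp
qed (rule assms(2))

lemma encode_closed:
  assumes "fb_tableau n T"
  shows "closed_set n (encode n T)"
proof -
  have "CI i j Green \<in> encode n T" if "CI i j s \<in> encode n T" for i j s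
    using that by (cases s) (auto simp: encode_def colored_intervals_iff)
  moreover have "CI i j Red \<in> encode n T"
    if R: "CI i k Red \<in> encode n T" and G: "CI (Suc i) j Green \<in> encode n T" and "k < j" for i j k
  proof -
    obtain u where "u \<le> Suc i" "(u, j) \<in> T" using G by (auto simp: encode_def)
    \<comment> \<open>Red \<open>[i, k]\<close> empties row \<open>Suc i\<close> beyond column
      \<open>k\<close>, so the witness for Green \<open>[i + 1, j]\<close> must lie in row
      \<open>i\<close> or higher up.\<close>
    moreover have "(Suc i, j) \<notin> T" using R \<open>k < j\<close> by (simp add: encode_def)
    ultimately have "\<exists>u\<le>i. (u, j) \<in> T" by (auto simp: le_Suc_eq)
    then show ?thesis
      using R G \<open>k < j\<close> by (auto simp: encode_def colored_intervals_iff)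
  qed
  moreover have "CI i j Blue \<in> encode n T" if "CI i j Red \<in> encode n T" "i < j" for i j
    using that by (auto simp: encode_def colored_intervals_iff)
  moreover have "CI (Suc i) j Green \<in> encode n T" if "CI i j Green \<in> encode n T" "i < j" for i j
    using that by (auto simp: encode_def colored_intervals_iff intro: le_SucI)
  moreover have "encode n T \<subseteq> colored_intervals n" by (auto simp: encode_def)
  ultimately show ?thesis unfolding closed_set_def by blast
qed

text \<open>The second and third sets contain the up-arrows and the left-arrows in the leftmost column;
  the last one contains the other left-arrows, for which \<open>CI i j Red \<in> X\<close>, and the dots.\<close>

definition decode :: "nat \<Rightarrow> colored_interval set \<Rightarrow> cell set" where
  "decode n X = insert (root n) (border n) \<union>
    {(i, j) | i j. CI i j Green \<in> X \<and> CI (i - 1) j Green \<notin> X} \<union>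
    {(Suc i, n) | i. 1 \<le> i \<and> i < n \<and> (\<forall>k. CI i k Red \<notin> X)} \<union>
    {(Suc i, j) | i j. CI i j Blue \<in> X \<and> (\<forall>k<j. CI i k Red \<notin> X)}"

lemma decode_iff:
  "(a, j) \<in> decode n X \<longleftrightarrow> (a, j) = (1, n) \<or> (2 \<le> a \<and> a \<le> n \<and> j = a - 1) \<or>
    (CI a j Green \<in> X \<and> CI (a - 1) j Green \<notin> X) \<or>
    (\<exists>i. a = Suc i \<and> j = n \<and> 1 \<le> i \<and> i < n \<and> (\<forall>k. CI i k Red \<notin> X)) \<or>
    (\<exists>i. a = Suc i \<and> CI i j Blue \<in> X \<and> (\<forall>k<j. CI i k Red \<notin> X))"
  by (auto simp: decode_def root_def border_def)

lemma decode_green: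
  assumes X: "closed_set n X" and ij: "1 \<le> i" "i \<le> j" "j < n"
  shows "(\<exists>u\<le>i. (u, j) \<in> decode n X) \<longleftrightarrow> CI i j Green \<in> X"
proof
  assume "\<exists>u\<le>i. (u, j) \<in> decode n X"
  then obtain u where u: "u \<le> i" "(u, j) \<in> decode n X" by blast
  then have "\<exists>v\<le>u. CI v j Green \<in> X"
    using ij closed_setD(2)[OF X] by (auto simp: decode_iff intro: le_SucI)
  then show "CI i j Green \<in> X"
    using closed_set_green_mono[OF X] u ij by (meson le_trans)
next
  assume G: "CI i j Green \<in> X"
  define u where "u = (LEAST v. CI v j Green \<in> X)"
  have u: "CI u j Green \<in> X" unfolding u_def using G by (rule LeastI)
  have "u \<le> i" unfolding u_def using G by (rule Least_le)
  \<comment> \<open>Intervals start at 1 or later, so \<open>u - 1\<close> is really smaller than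
    \<open>u\<close> and minimality applies.\<close>
  have "CI (u - 1) j Green \<notin> X"
    using closed_setD(1)[OF X u] not_less_Least[of "u - 1" "\<lambda>v. CI v j Green \<in> X"]
    by (simp flip: u_def)
  then show "\<exists>u\<le>i. (u, j) \<in> decode n X" using u \<open>u \<le> i\<close> by (auto simp: decode_iff)
qed

text \<open>The left-arrow of row \<open>Suc i\<close> is placed at the least \<open>k\<close> with
  Red \<open>[i, k]\<close>, or in column \<open>n\<close> if there is none. Any nonempty cell
  further left would be an up-arrow, and the last closure rule would make Green hold one row above
  it.\<close>

lemma decode_red:
  assumes X: "closed_set n X" and ij: "1 \<le> i" "i \<le> j" "j < n"
  shows "(\<forall>k>j. (Suc i, k) \<notin> decode n X) \<longleftrightarrow> (\<exists>k\<le>j. CI i k Red \<in> X)"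
proof
  assume L: "\<forall>k>j. (Suc i, k) \<notin> decode n X"
  then have "(Suc i, n) \<notin> decode n X" using ij by simp
  then obtain m where m: "CI i m Red \<in> X" using ij by (auto simp: decode_iff)
  define k where "k = (LEAST m. CI i m Red \<in> X)"
  have k: "CI i k Red \<in> X" "\<forall>m<k. CI i m Red \<notin> X"
    unfolding k_def using m by (rule LeastI) (use not_less_Least in blast)
  have "k \<le> j"
  proof (rule ccontr)
    assume "\<not> k \<le> j"
    then have "CI i k Blue \<in> X" using closed_setD(3)[OF X k(1)] ij by simp
    then have "(Suc i, k) \<in> decode n X" using k(2) by (auto simp: decode_iff)
    then show False using L \<open>\<not> k \<le> j\<close> by simp
  qed
  then show "\<exists>k\<le>j. CI i k Red \<in> X" using k(1) by blast
next
  assume "\<exists>k\<le>j. CI i k Red \<in> X"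
  then obtain m where m: "m \<le> j" "CI i m Red \<in> X" by blast
  show "\<forall>k>j. (Suc i, k) \<notin> decode n X"
  proof (intro allI impI notI)
    fix k assume k: "j < k" and "(Suc i, k) \<in> decode n X"
    then have "CI (Suc i) k Green \<in> X" "CI i k Green \<notin> X"
      using m ij by (auto simp: decode_iff)
    then show False
      using closed_setD(5)[OF X m(2), of k] closed_setD(2)[OF X, of i k Red] m(1) k by simp
  qed
qed

text \<open>Green \<open>[i, j]\<close> passes to \<open>[i + 1, j]\<close>, where the last closure
  rule combines it with Red \<open>[i, k]\<close>.\<close>

lemma closed_set_red_mono:
  assumes X: "closed_set n X" and "CI i k Red \<in> X" "k \<le> j" "CI i j Green \<in> X"
  shows "CI i j Red \<in> X"
proof (cases "k = j")
  case False
  then have "k < j" "i < j" using assms closed_setD(1)[OF X assms(2)] by auto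
  then show ?thesis using closed_setD(4)[OF X assms(4)] closed_setD(5)[OF X assms(2)] by blast
qed (use assms in simp)

lemma encode_decode:
  assumes X: "closed_set n X"
  shows "encode n (decode n X) = X"
proof -
  have "holds (decode n X) (CI i j s) \<longleftrightarrow> CI i j s \<in> X"
    if ij: "1 \<le> i" "i \<le> j" "j < n" and "s = Blue \<longrightarrow> i < j" for i j s
  proof -
    note G = decode_green[OF X ij] and R = decode_red[OF X ij]
    have red: "CI i j Green \<in> X \<and> (\<exists>k\<le>j. CI i k Red \<in> X) \<longleftrightarrow> CI i j Red \<in> X"
      using closed_set_red_mono[OF X] closed_setD(2)[OF X] by blast
    show ?thesis
    proof (cases s)
      case Blue
      then have "i < j" using that by simp
      \<comment> \<open>With Green present and no Red up to \<open>j\<close>, every clause of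
        \<open>decode\<close> except the blue one is ruled out for this cell.\<close>
      have cell: "(Suc i, j) \<in> decode n X \<longleftrightarrow> CI i j Blue \<in> X"
        if "CI i j Green \<in> X" "\<not> (\<exists>k\<le>j. CI i k Red \<in> X)"
        using that ij \<open>i < j\<close> by (auto simp: decode_iff)
      have "CI i j Green \<in> X \<and> ((\<exists>k\<le>j. CI i k Red \<in> X) \<or> (Suc i, j) \<in> decode n X)
          \<longleftrightarrow> CI i j Blue \<in> X"
        using cell red closed_setD(2)[OF X, of i j Blue] closed_setD(3)[OF X _ \<open>i < j\<close>] by blast
      then show ?thesis using Blue G R by simp
    qed (use G R red in simp_all)
  qed
  note this[of "lo p" "hi p" "col p" for p, unfolded colored_interval.collapse]
  moreover have "X \<subseteq> colored_intervals n" using X by (simp add: closed_set_def)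
  moreover have "1 \<le> lo p \<and> lo p \<le> hi p \<and> hi p < n \<and> (col p = Blue \<longrightarrow> lo p < hi p)"
    if "p \<in> colored_intervals n" for p
    using that by (cases p) (simp add: colored_intervals_iff)
  ultimately show ?thesis unfolding encode_def by blast
qed

text \<open>A parent above comes from \<open>decode_green\<close>, a parent to the left from
  \<open>decode_red\<close>; the root serves row 1 and column \<open>n\<close>.\<close>

lemma decode_fb_tableau:
  assumes X: "closed_set n X" and n: "1 \<le> n"
  shows "fb_tableau n (decode n X)"
proof -
  let ?T = "decode n X"
  have "c \<in> board n" if "c \<in> ?T" for c
  proof -
    obtain a j where c: "c = (a, j)" by (cases c)
    have "CI a j Green \<in> X \<Longrightarrow> (a, j) \<in> board n"
      using closed_setD(1)[OF X, of a j Green] by (auto simp: board_iff)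
    moreover have "CI i j Blue \<in> X \<Longrightarrow> (Suc i, j) \<in> board n" for i
      using closed_setD(1)[OF X, of i j Blue] by (auto simp: board_iff)
    moreover have "(1, n) \<in> board n" using n by (simp add: board_iff)
    ultimately show ?thesis
      using that by (auto simp: c decode_iff board_iff)
  qed
  moreover have "root n \<in> ?T" "border n \<subseteq> ?T" by (auto simp: decode_def)
  moreover have "(\<exists>k>j. (a, k) \<in> ?T) \<or> (\<exists>u<a. (u, j) \<in> ?T)"
    if c: "(a, j) \<in> ?T" "(a, j) \<noteq> (1, n)" for a j
  proof -
    have left: "\<exists>k>j. (Suc i, k) \<in> ?T"
      if "1 \<le> i" "i \<le> j" "j < n" "\<And>k. k \<le> j \<Longrightarrow> CI i k Red \<notin> X" for i j
      using decode_red[OF X that(1-3)] that(4) by blast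
    have above: "\<exists>u<Suc i. (u, j) \<in> ?T" if "CI i j Green \<in> X" for i j
      using decode_green[OF X, of i j] closed_setD(1)[OF X that] that
      by (simp add: less_Suc_eq_le)
    have root: "(1, n) \<in> ?T" by (simp add: decode_iff)
    consider (border) "2 \<le> a" "a \<le> n" "j = a - 1"
      | (green) "CI a j Green \<in> X" "CI (a - 1) j Green \<notin> X"
      | (last_column) "1 < a" "j = n"
      | (blue) i where "a = Suc i" "CI i j Blue \<in> X"
      using c by (auto simp: decode_iff)
    then show ?thesis
    proof cases
      case border
      then have a: "a = Suc j" "1 \<le> j" "j < n" by auto
      show ?thesis
      proof (cases "CI j j Green \<in> X")
        case False
        then have "CI j k Red \<notin> X" if "k \<le> j" for k
          using closed_setD(1,2)[OF X, of j k Red] that by (cases "k = j") auto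
        then show ?thesis using left[of j j] a by simp
      qed (use above a in simp)
    next
      case green
      note aj = closed_setD(1)[OF X green(1)]
      show ?thesis
      proof (cases "a = 1")
        case True
        then show ?thesis using aj root by blast
      next
        case False
        then obtain i where i: "a = Suc i" "1 \<le> i" using aj by (cases a) auto
        \<comment> \<open>A Red \<open>[i, k]\<close> would, together with Green
          \<open>[i + 1, j]\<close>, give Red and hence Green on \<open>[i, j]\<close>, although
          \<open>(a, j)\<close> is where Green starts in this column.\<close>
        have "CI i k Red \<notin> X" if "k \<le> j" for k
          using closed_setD(5)[OF X, of i k j] closed_setD(2)[OF X, of i j Red] green i that
          by (cases "k = j") auto
        then show ?thesis using left[of i j] aj i by simp
      qed
    next
      case last_column
      then show ?thesis using root by blast
    next
      case (blue i)
      then show ?thesis using above closed_setD(2)[OF X] by blast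
    qed
  qed
  then have "\<forall>c\<in>?T. c \<noteq> root n \<longrightarrow> (\<exists>d\<in>?T. left_of d c \<or> above d c)"
    unfolding root_def left_of_def above_def by (metis fst_conv snd_conv surj_pair)
  ultimately show ?thesis unfolding fb_tableau_def by blast
qed

lemma encode_image:
  assumes "1 \<le> n"
  shows "encode n ` carrier (esTam n) = {X. closed_set n X}"
proof (intro equalityI subsetI)
  show "X \<in> encode n ` carrier (esTam n)" if "X \<in> {X. closed_set n X}" for X
    using encode_decode[of n X] decode_fb_tableau[of n X] that assms
    by (simp add: esTam_def rev_image_eqI)
qed (auto simp: esTam_def encode_closed)


section \<open>The closure operator on colored intervals\<close>

inductive_set closure :: "colored_interval set \<Rightarrow> colored_interval set" for A where
  base: "p \<in> A \<Longrightarrow> p \<in> closure A"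
| join: "CI i k Red \<in> closure A \<Longrightarrow> CI (Suc i) j Green \<in> closure A \<Longrightarrow> k < j \<Longrightarrow> CI i j s \<in> closure A"

lemma closure_mono: "A \<subseteq> B \<Longrightarrow> closure A \<subseteq> closure B"
proof
  show "p \<in> closure B" if "A \<subseteq> B" "p \<in> closure A" for p
    using that(2) by induction (use that(1) in \<open>auto intro: closure.intros\<close>)
qed

lemma closure_eqI:
  assumes "\<And>i j k s. CI i k Red \<in> A \<Longrightarrow> CI (Suc i) j Green \<in> A \<Longrightarrow> k < j \<Longrightarrow> CI i j s \<in> A"
  shows "closure A = A"
proof
  show "closure A \<subseteq> A"
  proof
    show "p \<in> A" if "p \<in> closure A" for p
      using that by induction (use assms in auto)
  qed
qed (auto intro: closure.base)

lemma closure_closed_set: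
  assumes X: "closed_set n X"
  shows "closure X = X"
proof (rule closure_eqI)
  fix i j k s assume *: "CI i k Red \<in> X" "CI (Suc i) j Green \<in> X" "k < j"
  have "CI i j Red \<in> X" using closed_setD(5)[OF X *] .
  moreover have "i < j" using closed_setD(1)[OF X *(1)] *(3) by simp
  ultimately show "CI i j s \<in> X"
    using closed_setD(2,3)[OF X, of i j] by (cases s) auto
qed

text \<open>The premises give \<open>i \<le> k < j < n\<close>, so \<open>[i, j]\<close> is off the
  diagonal and exists in all three colors.\<close>

lemma closure_subset_intervals:
  assumes "A \<subseteq> colored_intervals n"
  shows "closure A \<subseteq> colored_intervals n"
proof
  show "p \<in> colored_intervals n" if "p \<in> closure A" for p
    using that by induction (use assms in \<open>auto simp: colored_intervals_iff\<close>)
qed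

text \<open>A newly derived interval is derived in every color, and one of its premises is Green
  \<open>[i + 1, j]\<close>. These are exactly the conclusions that the other rules would draw from
  it.\<close>

lemma closure_Un_closed:
  assumes X: "closed_set n X" and Y: "closed_set n Y"
  shows "closed_set n (closure (X \<union> Y))"
proof -
  let ?C = "closure (X \<union> Y)"
  have sub: "?C \<subseteq> colored_intervals n"
    using X Y by (intro closure_subset_intervals) (auto simp: closed_set_def)
  have cases: "CI i j s \<in> X \<or> CI i j s \<in> Y \<or>
      (\<forall>t. CI i j t \<in> ?C) \<and> CI (Suc i) j Green \<in> ?C"
    if "CI i j s \<in> ?C" for i j s
    using that by cases (auto intro: closure.join)
  have base: "p \<in> X \<or> p \<in> Y \<Longrightarrow> p \<in> ?C" for p
    by (auto intro: closure.base)
  have "CI i j Green \<in> ?C" if "CI i j s \<in> ?C" for i j s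
    using cases[OF that] closed_setD(2)[OF X] closed_setD(2)[OF Y] base by blast
  moreover have "CI i j Blue \<in> ?C" if "CI i j Red \<in> ?C" "i < j" for i j
    using cases[OF that(1)] closed_setD(3)[OF X _ that(2)] closed_setD(3)[OF Y _ that(2)] base
    by blast
  moreover have "CI (Suc i) j Green \<in> ?C" if "CI i j Green \<in> ?C" "i < j" for i j
    using cases[OF that(1)] closed_setD(4)[OF X _ that(2)] closed_setD(4)[OF Y _ that(2)] base
    by blast
  moreover have "CI i j Red \<in> ?C"
    if "CI i k Red \<in> ?C" "CI (Suc i) j Green \<in> ?C" "k < j" for i j k
    using that by (rule closure.join)
  ultimately show ?thesis using sub unfolding closed_set_def by blast
qed

lemma closed_set_Int:
  assumes X: "closed_set n X" and Y: "closed_set n Y"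
  shows "closed_set n (X \<inter> Y)"
  unfolding closed_set_def
proof (intro conjI allI impI)
  show "X \<inter> Y \<subseteq> colored_intervals n" using X by (auto simp: closed_set_def)
  show "CI i j Green \<in> X \<inter> Y" if "CI i j s \<in> X \<inter> Y" for i j s
    using that closed_setD(2)[OF X, of i j s] closed_setD(2)[OF Y, of i j s] by simp
  show "CI i j Blue \<in> X \<inter> Y" if "CI i j Red \<in> X \<inter> Y" "i < j" for i j
    using that closed_setD(3)[OF X, of i j] closed_setD(3)[OF Y, of i j] by simp
  show "CI (Suc i) j Green \<in> X \<inter> Y" if "CI i j Green \<in> X \<inter> Y" "i < j" for i j
    using that closed_setD(4)[OF X, of i j] closed_setD(4)[OF Y, of i j] by simp
  show "CI i j Red \<in> X \<inter> Y"
    if "CI i k Red \<in> X \<inter> Y" "CI (Suc i) j Green \<in> X \<inter> Y" "k < j" for i j k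
    using that closed_setD(5)[OF X, of i k j] closed_setD(5)[OF Y, of i k j] by simp
qed

text \<open>Both premises of the rule lie below its conclusion in the inclusion poset, so a
  derivation of an element of the down-set \<open>N\<close> never leaves \<open>N\<close>.\<close>

lemma closure_local:
  assumes A: "A \<subseteq> colored_intervals n" and N: "order_ideal (interval_poset n) N"
  shows "closure A \<inter> N \<subseteq> closure (A \<inter> N)"
proof -
  have down: "p \<in> N" if "interval_le p q" "q \<in> N" "p \<in> closure A" for p q
    using N closure_subset_intervals[OF A] that unfolding order_ideal_def interval_poset_def
    by auto
  have "p \<in> N \<longrightarrow> p \<in> closure (A \<inter> N)" if "p \<in> closure A" for p
    using that
  proof induction
    case (join i k j s)
    then show ?case
      using down[OF interval_le.red[OF join.hyps(3)], of i s]
        down[OF interval_le.green[of i "Suc i"], of j s]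
      by (auto intro: closure.join)
  qed (auto intro: closure.base)
  then show ?thesis by blast
qed

section \<open>Join-irreducible closed sets and their lower covers\<close>

definition principal_set :: "colored_interval \<Rightarrow> colored_interval set" where
  "principal_set p = insert p ({CI a (hi p) Green | a. lo p \<le> a \<and> a \<le> hi p} \<union>
    (if col p = Red \<and> lo p < hi p then {CI (lo p) (hi p) Blue} else {}))"

lemma mem_principal_set:
  "CI a b t \<in> principal_set (CI i j s) \<longleftrightarrow> CI a b t = CI i j s \<or>
    (b = j \<and> t = Green \<and> i \<le> a \<and> a \<le> j) \<or> (a = i \<and> b = j \<and> t = Blue \<and> s = Red \<and> i < j)"
  by (auto simp: principal_set_def)

text \<open>All members share one right end, so the last closure rule, which needs two different
  ones, never fires. The other rules never lead back to \<open>p\<close>, so \<open>p\<close> can be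
  removed.\<close>

lemma principal_set_closed:
  assumes "p \<in> colored_intervals n"
  shows "closed_set n (principal_set p)" "closed_set n (principal_set p - {p})"
proof -
  obtain i j s where p: "p = CI i j s" by (cases p)
  have sub: "principal_set p \<subseteq> colored_intervals n"
  proof
    show "q \<in> colored_intervals n" if "q \<in> principal_set p" for q
      using that assms by (cases q) (auto simp: p mem_principal_set colored_intervals_iff)
  qed
  have ij: "i \<le> j" "s = Blue \<longrightarrow> i < j" using assms by (auto simp: p colored_intervals_iff)
  show "closed_set n (principal_set p)"
    unfolding closed_set_def using sub ij by (auto simp: p mem_principal_set)
  show "closed_set n (principal_set p - {p})"
    unfolding closed_set_def using sub ij by (auto simp: p mem_principal_set)
qed

lemma principal_set_least:
  assumes X: "closed_set n X" and p: "p \<in> X"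
  shows "principal_set p \<subseteq> X"
proof
  obtain i j s where p_eq: "p = CI i j s" by (cases p)
  have G: "CI i j Green \<in> X" using closed_setD(2)[OF X] p by (simp add: p_eq)
  show "q \<in> X" if q: "q \<in> principal_set p" for q
  proof -
    obtain a b t where "q = CI a b t" by (cases q)
    then show ?thesis
      using q p closed_set_green_mono[OF X G, of a] closed_setD(3)[OF X, of i j]
      by (auto simp: p_eq mem_principal_set)
  qed
qed

section \<open>Forcing between colored intervals\<close>

definition forces :: "nat \<Rightarrow> colored_interval \<Rightarrow> colored_interval \<Rightarrow> bool" where
  "forces n p q \<longleftrightarrow> p \<in> colored_intervals n \<and> q \<in> colored_intervals n \<and>
    (\<exists>Z. closed_set n Z \<and> q \<in> closure (principal_set p \<union> Z) \<and> q \<notin> closure (principal_set p - {p} \<union> Z))"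

text \<open>Take for \<open>Z\<close> the set generated by Green \<open>[i + 1, k]\<close>: with
  \<open>p\<close> the rule yields \<open>[i, k]\<close> in any color, while without
  \<open>p\<close> no red interval is left to start from.\<close>

lemma forces_red:
  assumes "CI i j Red \<in> colored_intervals n" "CI i k s \<in> colored_intervals n" "j < k"
  shows "forces n (CI i j Red) (CI i k s)"
proof -
  let ?p = "CI i j Red" and ?r = "CI (Suc i) k Green"
  have "?r \<in> colored_intervals n" using assms by (auto simp: colored_intervals_iff)
  then have "closed_set n (principal_set ?r)" by (rule principal_set_closed)
  moreover have "CI i k s \<in> closure (principal_set ?p \<union> principal_set ?r)"
    using assms by (intro closure.join[of i j _ k] closure.base) (auto simp: principal_set_def)
  moreover have "closure (principal_set ?p - {?p} \<union> principal_set ?r) = principal_set ?p - {?p} \<union> principal_set ?r"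
    by (rule closure_eqI) (auto simp: mem_principal_set)
  moreover have "CI i k s \<notin> principal_set ?p - {?p} \<union> principal_set ?r"
    using assms by (auto simp: mem_principal_set)
  ultimately show ?thesis using assms unfolding forces_def by metis
qed

text \<open>The partner is now the diagonal Red \<open>[i, i]\<close>. Without \<open>p\<close>, the
  remaining green intervals ending at \<open>j\<close> start at \<open>i + 2\<close> or later, so
  the rule does not apply.\<close>

lemma forces_green_Suc:
  assumes "CI (Suc i) j Green \<in> colored_intervals n" "CI i j s \<in> colored_intervals n"
  shows "forces n (CI (Suc i) j Green) (CI i j s)"
proof -
  let ?p = "CI (Suc i) j Green" and ?r = "CI i i Red"
  have "?r \<in> colored_intervals n" using assms by (auto simp: colored_intervals_iff)
  then have "closed_set n (principal_set ?r)" by (rule principal_set_closed)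
  moreover have "CI i j s \<in> closure (principal_set ?p \<union> principal_set ?r)"
    using assms by (intro closure.join[of i i _ j] closure.base)
      (auto simp: principal_set_def colored_intervals_iff)
  moreover have "closure (principal_set ?p - {?p} \<union> principal_set ?r) = principal_set ?p - {?p} \<union> principal_set ?r"
    by (rule closure_eqI) (auto simp: mem_principal_set)
  moreover have "CI i j s \<notin> principal_set ?p - {?p} \<union> principal_set ?r"
    using assms by (auto simp: mem_principal_set colored_intervals_iff)
  ultimately show ?thesis using assms unfolding forces_def by metis
qed

text \<open>The left end moves down by one at a time through green intervals; only the last step
  takes the color \<open>s\<close>.\<close>

lemma forces_green:
  assumes "CI i j Green \<in> colored_intervals n" "CI k j s \<in> colored_intervals n" "k < i"
  shows "(forces n)\<^sup>*\<^sup>* (CI i j Green) (CI k j s)"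
proof -
  have forces: "forces n (CI (Suc a) j Green) (CI a j t)"
    if "k \<le> a" "a < i" "t = Blue \<longrightarrow> s = Blue" for a t
    using assms that by (intro forces_green_Suc) (auto simp: colored_intervals_iff)
  have "(forces n)\<^sup>*\<^sup>* (CI i j Green) (CI (Suc k) j Green)"
    using Suc_leI[OF assms(3)]
  proof (induction rule: inc_induct)
    case (step a)
    then show ?case
      using forces[of a Green]
      by (simp add: rtranclp.rtrancl_into_rtrancl)
  qed simp
  then show ?thesis using forces[of k s] assms(3) by (simp add: rtranclp.rtrancl_into_rtrancl)
qed

text \<open>An inner inclusion moves both ends. From Red the right end moves first, via Green
  \<open>[i, l]\<close>; from Green the left end moves first, via Red \<open>[k, j]\<close>.\<close>

lemma interval_le_forces:
  assumes "interval_le p q" "p \<in> colored_intervals n" "q \<in> colored_intervals n"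
  shows "(forces n)\<^sup>*\<^sup>* p q"
  using assms
proof cases
  case (red j k i s)
  then show ?thesis using assms by (auto intro: forces_red)
next
  case (green k i j s)
  then show ?thesis using assms by (auto intro: forces_green)
next
  case (inner k i j l s t)
  show ?thesis
  proof (cases "s = Red")
    case True
    then have "(forces n)\<^sup>*\<^sup>* p (CI i l Green)"
      using inner assms by (auto intro!: r_into_rtranclp[of "forces n"] forces_red simp: colored_intervals_iff)
    moreover have "(forces n)\<^sup>*\<^sup>* (CI i l Green) q"
      using inner assms by (auto intro!: forces_green simp: colored_intervals_iff)
    ultimately show ?thesis by simp
  next
    case False
    then have "(forces n)\<^sup>*\<^sup>* p (CI k j Red)"
      using inner assms by (auto intro!: forces_green simp: colored_intervals_iff)
    moreover have "(forces n)\<^sup>*\<^sup>* (CI k j Red) q"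
      using inner assms by (auto intro!: r_into_rtranclp[of "forces n"] forces_red simp: colored_intervals_iff)
    ultimately show ?thesis by simp
  qed
qed simp

section \<open>The tableaux as an instance of the abstract setting\<close>

lemma finite_colored_intervals: "finite (colored_intervals n)"
proof -
  have "colored_intervals n \<subseteq> (\<Union>i\<le>n. \<Union>j\<le>n. CI i j ` {Red, Green, Blue})"
    by (auto simp: colored_intervals_def)
  then show ?thesis by (rule finite_subset) auto
qed

lemma esTam_labelled:
  assumes n: "n \<ge> 1"
  shows "labelled_set_lattice (esTam n) (encode n) closure (interval_poset n)
    (\<lambda>p. decode n (principal_set p)) (\<lambda>p. decode n (principal_set p - {p}))"
proof -
  note img = encode_image[OF n]
  have carrier_eq: "carrier (esTam n) = {T. fb_tableau n T}" "carrier (interval_poset n) = colored_intervals n"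
    by (simp_all add: esTam_def interval_poset_def)
  have le_iff: "S \<sqsubseteq>\<^bsub>esTam n\<^esub> T \<longleftrightarrow> encode n S \<subseteq> encode n T"
    if "S \<in> carrier (esTam n)" "T \<in> carrier (esTam n)" for S T
    using that fb_le_encode[of n S T] encode_fb_le[of n S T] by (auto simp: esTam_def)
  have closed: "closed_set n (encode n T)" if "T \<in> carrier (esTam n)" for T
    using that encode_closed by (simp add: esTam_def)
  show ?thesis
  proof
    show "inj_on (encode n) (carrier (esTam n))"
    proof (rule inj_onI)
      fix S T assume "S \<in> carrier (esTam n)" "T \<in> carrier (esTam n)" "encode n S = encode n T"
      then show "S = T" using fb_le_antisym encode_fb_le by (simp add: carrier_eq)
    qed
    show "p \<in> carrier (interval_poset n) \<Longrightarrow> decode n (principal_set p) \<in> carrier (esTam n)" for p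
      using decode_fb_tableau[OF principal_set_closed(1) n] by (simp add: carrier_eq)
    show "p \<in> carrier (interval_poset n) \<Longrightarrow> decode n (principal_set p - {p}) \<in> carrier (esTam n)" for p
      using decode_fb_tableau[OF principal_set_closed(2) n] by (simp add: carrier_eq)
    show "p \<in> carrier (interval_poset n) \<Longrightarrow> p \<in> encode n (decode n (principal_set p))" for p
      by (simp add: carrier_eq encode_decode principal_set_closed) (simp add: principal_set_def)
    show "p \<in> carrier (interval_poset n) \<Longrightarrow>
        encode n (decode n (principal_set p - {p})) = encode n (decode n (principal_set p)) - {p}" for p
      by (simp add: carrier_eq encode_decode principal_set_closed)
    show "T \<in> carrier (esTam n) \<Longrightarrow> p \<in> encode n T \<Longrightarrow> encode n (decode n (principal_set p)) \<subseteq> encode n T"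
      for T p
      using principal_set_least[OF closed] encode_decode[OF principal_set_closed(1)]
      by (simp add: encode_def)
    show "p \<in> carrier (interval_poset n) \<Longrightarrow> q \<in> carrier (interval_poset n) \<Longrightarrow>
        p \<sqsubseteq>\<^bsub>interval_poset n\<^esub> q \<Longrightarrow>
        (\<lambda>p q. p \<in> carrier (interval_poset n) \<and> q \<in> carrier (interval_poset n) \<and>
          (\<exists>z\<in>carrier (esTam n).
            q \<in> closure (encode n (decode n (principal_set p)) \<union> encode n z) \<and>
            q \<notin> closure (encode n (decode n (principal_set p - {p})) \<union> encode n z)))\<^sup>*\<^sup>* p q" for p q
    proof -
      assume pq: "p \<in> carrier (interval_poset n)" "q \<in> carrier (interval_poset n)"
        "p \<sqsubseteq>\<^bsub>interval_poset n\<^esub> q"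
      then have "(forces n)\<^sup>*\<^sup>* p q" by (intro interval_le_forces) (simp_all add: interval_poset_def)
      then show ?thesis
      \<comment> \<open>\<open>forces\<close> is stated with closed sets; since every closed set
        encodes a tableau, each single step translates into one between tableaux.\<close>
      proof (rule mono_rtranclp[rule_format, rotated])
        fix p q assume "forces n p q"
        then obtain Z where Z: "p \<in> colored_intervals n" "q \<in> colored_intervals n" "closed_set n Z"
          "q \<in> closure (principal_set p \<union> Z)" "q \<notin> closure (principal_set p - {p} \<union> Z)"
          unfolding forces_def by blast
        have "Z \<in> encode n ` carrier (esTam n)" using Z(3) by (simp add: img)
        then obtain z where z: "z \<in> carrier (esTam n)" "Z = encode n z" by (rule imageE)
        then show "p \<in> carrier (interval_poset n) \<and> q \<in> carrier (interval_poset n) \<and>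
          (\<exists>z\<in>carrier (esTam n).
            q \<in> closure (encode n (decode n (principal_set p)) \<union> encode n z) \<and>
            q \<notin> closure (encode n (decode n (principal_set p - {p})) \<union> encode n z))"
          unfolding carrier_eq(2) encode_decode[OF principal_set_closed(1)[OF Z(1)]]
            encode_decode[OF principal_set_closed(2)[OF Z(1)]]
          using Z unfolding z(2) by (intro conjI bexI[OF _ z(1)])
      qed
    qed
    show "X \<in> encode n ` carrier (esTam n) \<Longrightarrow> closure X = X" for X
      by (simp add: img closure_closed_set)
    show "S \<in> carrier (esTam n) \<Longrightarrow> T \<in> carrier (esTam n) \<Longrightarrow>
        S \<sqsubseteq>\<^bsub>esTam n\<^esub> T \<longleftrightarrow> encode n S \<subseteq> encode n T" for S T
      by (rule le_iff)
    show "X \<in> encode n ` carrier (esTam n) \<Longrightarrow> Y \<in> encode n ` carrier (esTam n) \<Longrightarrow>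
        X \<inter> Y \<in> encode n ` carrier (esTam n)" for X Y
      by (simp add: img closed_set_Int)
    show "X \<in> encode n ` carrier (esTam n) \<Longrightarrow> Y \<in> encode n ` carrier (esTam n) \<Longrightarrow>
        closure (X \<union> Y) \<in> encode n ` carrier (esTam n)" for X Y
      by (simp add: img closure_Un_closed)
    show "A \<subseteq> carrier (interval_poset n) \<Longrightarrow> order_ideal (interval_poset n) N \<Longrightarrow>
        closure A \<inter> N \<subseteq> closure (A \<inter> N)" for A N
      using closure_local by (simp add: carrier_eq)
    show "A \<subseteq> B \<Longrightarrow> closure A \<subseteq> closure B" for A B by (rule closure_mono)
  qed (auto simp: carrier_eq(2) finite_colored_intervals encode_def esTam_def closure.base)
qed

theorem theorem1p5:
  fixes n :: nat
  assumes "n \<ge> 1"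
  shows "lattice (esTam n) \<and>
    order_isomorphic (congruence_lattice (esTam n)) (ideal_lattice (inv_gorder (interval_poset n)))"
proof -
  interpret labelled_set_lattice "esTam n" "encode n" closure "interval_poset n"
    "\<lambda>p. decode n (principal_set p)" "\<lambda>p. decode n (principal_set p - {p})"
    by (rule esTam_labelled[OF assms])
  show ?thesis using lattice_axioms congruence_lattice_isomorphic by blast
qed

end
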